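(* Assume that $\bar x\in C$ satisfies the robust (KKT) condition. (i) If $(f\circ F,g\circ G)$ is type I pseudo convex at $\bar x$, then $\bar x\in\mathcal S^{w}(\mathrm{CRP})$, i.e. $\bar x$ is a weakly robust efficient solution of $(\mathrm{CUP})$. (ii) If $(f\circ F,g\circ G)$ is type II pseudo convex at $\bar x$, then $\bar x\in\mathcal S(\mathrm{CRP})$, i.e. $\bar x$ is a robust efficient solution of $(\mathrm{CUP})$.
   Context: Setting. $X,W,Y,Z$ are Asplund spaces; $F:X\to W$, $f:W\to Y$; $K\subset Y$ is a pointed closed convex cone with nonempty interior; $K^+=\{y^*\in Y^*\mid\langle y^*,y\rangle\ge 0\ \forall y\in K\}$. For $i=1,\dots,n$, $\mathcal V_i$ is a (nonempty) sequentially compact topological space, $\mathcal U_i$ a topological space, $G_i:X\times\mathcal V_i\to Z\times\mathcal U_i$, $g_i:Z\times\mathcal U_i\to\mathbb R$. Problem $(\mathrm{CUP})$: minimize $(f\circ F)(x)$ with respect to $K$ subject to $(g_i\circ G_i)(x,v_i)\le 0$, $i=1,\dots,n$, with uncertain $v_i\in\mathcal V_i$. Its robust counterpart $(\mathrm{CRP})$ has feasible set $C=\{x\in X\mid (g_i\circ G_i)(x,v_i)\le 0\ \forall v_i\in\mathcal V_i,\ i=1,\dots,n\}$. $\bar x\in\mathcal S(\mathrm{CRP})$ (robust efficient solution) means $\bar x\in C$ and $(f\circ F)(x)-(f\circ F)(\bar x)\notin -K\setminus\{0\}$ for all $x\in C$; $\bar x\in\mathcal S^w(\mathrm{CRP})$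 (weakly robust efficient solution) means $\bar x\in C$ and $(f\circ F)(x)-(f\circ F)(\bar x)\notin-\mathrm{int}\,K$ for all $x\in C$. Notation. $\partial$ is the limiting (Mordukhovich) subdifferential. $\langle y^*,f\rangle(w):=\langle y^*,f(w)\rangle$. $\mathrm{cl}^*\mathrm{co}$ is the weak$^*$ closed convex hull. $\partial_x$ is the limiting subdifferential in the first variable with the parameter held fixed; writing $G_i(x,v_i)=(\tilde G_i(x,v_i),\gamma_i(x,v_i))\in Z\times\mathcal U_i$, $\partial_x g_i(G_i(\bar x,v_i))\subset Z^*$ is the limiting subdifferential of $g_i(\cdot,\gamma_i(\bar x,v_i))$ at $\tilde G_i(\bar x,v_i)$, and $\langle v_i^*,G_i\rangle(x,v_i):=\langle v_i^*,\tilde G_i(x,v_i)\rangle$. Put $\phi_i(x)=\max_{v_i\in\mathcal V_i}(g_i\circ G_i)(x,v_i)$, $\phi=\max_i\phi_i$, $\mathcal V_i(\bar x)=\{v_i\in\mathcal V_i\mid(g_i\circ G_i)(\bar x,v_i)=\phi_i(\bar x)\}$. Standing assumptions at $\bar x$. (A1) $F$ is locally Lipschitz at $\bar x$ and $f$ at $F(\bar x)$. (A2) $\tilde G_i(\cdot,v_i)$ is Lipschitz on a neighborhood of $\bar x$ uniformly in $v_i\in\mathcal V_i$, and $g_i$ is Lipschitz in its $Z$-variable (uniformly) around the points of $G_i(\bar x,\mathcal V_i)$. (A3) $v_i\mapsto G_i(\bar x,v_i)$ and $g_i$ on $G_i(\bar x,\mathcal V_i)$ are locally Lipschitz (with respect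 to metrics inducing the topologies of $\mathcal V_i,\mathcal U_i$). (A4) $\phi_i,\phi$ are well-defined real-valued functions on $X$ (maxima attained), locally Lipschitz at $\bar x$. (A5) The multifunction $(x,v_i)\mapsto\partial_x(g_i\circ G_i)(x,v_i)$ is weak$^*$ sequentially closed at $(\bar x,\bar v_i)$ for each $\bar v_i\in\mathcal V_i(\bar x)$. Robust (KKT) condition. $\bar x\in C$ satisfies it if there exist $y^*\in K^+\setminus\{0\}$, $\mu\in\mathbb R^n_+$ and $\bar v_i\in\mathcal V_i$ such that $$0\in\bigcup_{w^*\in\partial\langle y^*,f\rangle(F(\bar x))}\partial\langle w^*,F\rangle(\bar x)+\sum_{i=1}^n\mu_i\,\mathrm{cl}^*\mathrm{co}\Big(\bigcup\Big\{\bigcup_{v_i^*\in\partial_x g_i(G_i(\bar x,v_i))}\partial_x\langle v_i^*,G_i\rangle(\bar x,v_i)\Big|v_i\in\mathcal V_i(\bar x)\Big\}\Big)$$ and $\mu_i\max_{v_i\in\mathcal V_i}(g_i\circ G_i)(\bar x,v_i)=\mu_i(g_i\circ G_i)(\bar x,\bar v_i)=0$, $i=1,\dots,n$. Pseudo convexity. $(f\circ F,g\circ G)$ is type I pseudo convex at $\bar x$ if for any $x\in X$, $y^*\in K^+$, $w^*\in\partial\langle y^*,f\rangle(F(\bar x))$, $x^*\in\partial\langle w^*,F\rangle(\bar x)$, $v_i^*\in\partial_x g_i(G_i(\bar x,v_i))$, and $x_i^*\in\partial_x\langle v_i^*,G_i\rangle(\bar x,v_i)$, $v_i\in\mathcal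 V_i(\bar x)$, $i=1,\dots,n$, there exists $\nu\in X$ such that $\langle y^*,f\circ F\rangle(x)<\langle y^*,f\circ F\rangle(\bar x)\Rightarrow\langle x^*,\nu\rangle<0$, and $(g_i\circ G_i)(x,v_i)\le(g_i\circ G_i)(\bar x,v_i)\Rightarrow\langle x_i^*,\nu\rangle\le 0$, $i=1,\dots,n$. It is type II pseudo convex at $\bar x$ if the same holds for any $x\in X\setminus\{\bar x\}$ and $y^*\in K^+\setminus\{0\}$ (other data as before), with the first implication replaced by $\langle y^*,f\circ F\rangle(x)\le\langle y^*,f\circ F\rangle(\bar x)\Rightarrow\langle x^*,\nu\rangle<0$.
   Formalization: In both types of pseudo convexity, one ν (depending on x, y*, w*, x* ) must serve all v_i in V_i(x̄), v_i* and x_i* at once; if ν may depend on the chosen x_i*, the claim fails (e.g. g = min(z1,z2), f = −w1−w2, x̄ = 0). *)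

theory Defs
  imports "HOL-Analysis.Analysis"
begin

section \<open>Asplund spaces and duality\<close>

type_synonym 'a dual = "'a \<Rightarrow>\<^sub>L real"

definition asplund_space :: "'a::banach itself \<Rightarrow> bool" where
  "asplund_space _ \<longleftrightarrow>
     (\<forall>(D :: 'a set) (h :: 'a \<Rightarrow> real).
        open D \<and> convex D \<and> convex_on D h \<and> continuous_on D h \<longrightarrow>
        (\<exists>S\<subseteq>D. D \<subseteq> closure S \<and> (\<forall>x\<in>S. h differentiable (at x))))"

text \<open>For real-valued bounded linear maps the strong operator topology is the
  topology of pointwise convergence, that is, the weak-star topology of the dual.\<close>

abbreviation weak_star :: "'a::real_normed_vector dual topology" where
  "weak_star \<equiv> strong_operator_topology"

definition weak_star_closed_hull :: "'a::real_normed_vector dual set \<Rightarrow> 'a dual set" where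
  "weak_star_closed_hull S = weak_star closure_of (convex hull S)"

definition dual_cone :: "'a::real_normed_vector set \<Rightarrow> 'a dual set" where
  "dual_cone K = {ys. \<forall>y\<in>K. 0 \<le> blinfun_apply ys y}"


section \<open>Limiting normals and subdifferentials\<close>

definition frechet_normal_cone :: "'a::real_normed_vector set \<Rightarrow> 'a \<Rightarrow> 'a dual set" where
  "frechet_normal_cone \<Omega> x =
     {xs. x \<in> \<Omega> \<and>
          Limsup (at x within \<Omega>) (\<lambda>u. ereal (blinfun_apply xs (u - x) / norm (u - x))) \<le> 0}"

text \<open>The sequential Painleve-Kuratowski outer limit, norm times weak-star, of the
  Frechet normal cones; this is Mordukhovich's normal cone in Asplund spaces.\<close>

definition limiting_normal_cone :: "'a::real_normed_vector set \<Rightarrow> 'a \<Rightarrow> 'a dual set" where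
  "limiting_normal_cone \<Omega> x =
     {xs. x \<in> \<Omega> \<and>
          (\<exists>(u :: nat \<Rightarrow> 'a) (us :: nat \<Rightarrow> 'a dual).
             (\<forall>k. u k \<in> \<Omega>) \<and> u \<longlonglongrightarrow> x \<and>
             (\<forall>k. us k \<in> frechet_normal_cone \<Omega> (u k)) \<and>
             limitin weak_star us xs sequentially)}"

text \<open>The functional \<open>(xs o\<^sub>L fst_blinfun) - snd_blinfun\<close> is the pair \<open>(xs, -1)\<close> regarded
  as an element of the dual of the product with the reals.\<close>

definition limiting_subdifferential ::
    "('a::real_normed_vector \<Rightarrow> real) \<Rightarrow> 'a \<Rightarrow> 'a dual set" where
  "limiting_subdifferential h x =
     {xs. (xs o\<^sub>L fst_blinfun) - snd_blinfun \<in> limiting_normal_cone (epigraph UNIV h) (x, h x)}"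

definition partial_subdifferential ::
    "('a::real_normed_vector \<times> 'p \<Rightarrow> real) \<Rightarrow> 'a \<times> 'p \<Rightarrow> 'a dual set" where
  "partial_subdifferential h = (\<lambda>(x, p). limiting_subdifferential (\<lambda>x'. h (x', p)) x)"

definition scalarization :: "'b::real_normed_vector dual \<Rightarrow> ('a \<Rightarrow> 'b) \<Rightarrow> 'a \<Rightarrow> real" where
  "scalarization ys h x = blinfun_apply ys (h x)"


section \<open>Lipschitz behaviour and topological notions\<close>

definition locally_lipschitz_at :: "('a::metric_space \<Rightarrow> 'b::metric_space) \<Rightarrow> 'a \<Rightarrow> bool" where
  "locally_lipschitz_at h x \<longleftrightarrow> (\<exists>\<delta>>0. \<exists>L. L-lipschitz_on (ball x \<delta>) h)"

definition locally_lipschitz_map :: "'a metric \<Rightarrow> 'b metric \<Rightarrow> ('a \<Rightarrow> 'b) \<Rightarrow> bool" where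
  "locally_lipschitz_map m1 m2 h \<longleftrightarrow>
     h \<in> mspace m1 \<rightarrow> mspace m2 \<and>
     (\<forall>x\<in>mspace m1. \<exists>r>0. Lipschitz_continuous_map (submetric m1 (mball_of m1 x r)) m2 h)"

definition sequentially_compact_space :: "'a topology \<Rightarrow> bool" where
  "sequentially_compact_space T \<longleftrightarrow>
     (\<forall>\<sigma> :: nat \<Rightarrow> 'a. range \<sigma> \<subseteq> topspace T \<longrightarrow>
        (\<exists>l r. strict_mono r \<and> limitin T (\<sigma> \<circ> r) l sequentially))"

definition weak_star_seq_closed_at ::
    "'p topology \<Rightarrow> ('a::real_normed_vector \<times> 'p \<Rightarrow> 'a dual set) \<Rightarrow> 'a \<times> 'p \<Rightarrow> bool" where
  "weak_star_seq_closed_at T M = (\<lambda>(x, p).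
     \<forall>(u :: nat \<Rightarrow> 'a) (q :: nat \<Rightarrow> 'p) us xs.
       (\<forall>k. q k \<in> topspace T) \<and> u \<longlonglongrightarrow> x \<and> limitin T q p sequentially \<and>
       (\<forall>k. us k \<in> M (u k, q k)) \<and> limitin weak_star us xs sequentially
       \<longrightarrow> xs \<in> M (x, p))"


section \<open>The robust problem\<close>

text \<open>The first group of definitions concerns one constraint: \<open>Vi\<close> is its uncertainty
  space and \<open>gi \<circ> Gi\<close> its uncertain constraint function.  The real supremum in
  \<open>worst_case\<close> is a maximum under \<open>maximum_attained\<close>.\<close>

definition maximum_attained ::
    "'v topology \<Rightarrow> ('x \<times> 'v \<Rightarrow> 'z \<times> 'u) \<Rightarrow> ('z \<times> 'u \<Rightarrow> real) \<Rightarrow> bool" where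
  "maximum_attained Vi Gi gi \<longleftrightarrow>
     (\<forall>x. \<exists>v\<in>topspace Vi. \<forall>v'\<in>topspace Vi. (gi \<circ> Gi) (x, v') \<le> (gi \<circ> Gi) (x, v))"

definition worst_case ::
    "'v topology \<Rightarrow> ('x \<times> 'v \<Rightarrow> 'z \<times> 'u) \<Rightarrow> ('z \<times> 'u \<Rightarrow> real) \<Rightarrow> 'x \<Rightarrow> real" where
  "worst_case Vi Gi gi x = (SUP v\<in>topspace Vi. (gi \<circ> Gi) (x, v))"

definition active_params ::
    "'v topology \<Rightarrow> ('x \<times> 'v \<Rightarrow> 'z \<times> 'u) \<Rightarrow> ('z \<times> 'u \<Rightarrow> real) \<Rightarrow> 'x \<Rightarrow> 'v set" where
  "active_params Vi Gi gi x = {v \<in> topspace Vi. (gi \<circ> Gi) (x, v) = worst_case Vi Gi gi x}"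

definition chain_subgradients ::
    "('x::real_normed_vector \<times> 'v \<Rightarrow> 'z::real_normed_vector \<times> 'u) \<Rightarrow> ('z \<times> 'u \<Rightarrow> real)
     \<Rightarrow> 'x \<times> 'v \<Rightarrow> 'x dual set" where
  "chain_subgradients Gi gi p =
     (\<Union>vs\<in>partial_subdifferential gi (Gi p).
        partial_subdifferential (scalarization vs (fst \<circ> Gi)) p)"

definition robust_feasible ::
    "nat \<Rightarrow> (nat \<Rightarrow> 'v topology) \<Rightarrow> (nat \<Rightarrow> 'x \<times> 'v \<Rightarrow> 'z \<times> 'u) \<Rightarrow> (nat \<Rightarrow> 'z \<times> 'u \<Rightarrow> real) \<Rightarrow> 'x set"
  where
  "robust_feasible n V G g =
     {x. \<forall>i\<in>{1..n}. \<forall>v\<in>topspace (V i). (g i \<circ> G i) (x, v) \<le> 0}"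

definition efficient_solutions ::
    "'y::real_normed_vector set \<Rightarrow> ('x \<Rightarrow> 'y) \<Rightarrow> 'x set \<Rightarrow> 'x set" where
  "efficient_solutions K h C = {x \<in> C. \<forall>x'\<in>C. h x' - h x \<notin> uminus ` K - {0}}"

definition weakly_efficient_solutions ::
    "'y::real_normed_vector set \<Rightarrow> ('x \<Rightarrow> 'y) \<Rightarrow> 'x set \<Rightarrow> 'x set" where
  "weakly_efficient_solutions K h C = {x \<in> C. \<forall>x'\<in>C. h x' - h x \<notin> uminus ` interior K}"

text \<open>The sums of sets in this definition are Minkowski sums.\<close>

definition robust_KKT ::
    "('x::real_normed_vector \<Rightarrow> 'w::real_normed_vector) \<Rightarrow> ('w \<Rightarrow> 'y::real_normed_vector)
     \<Rightarrow> 'y set \<Rightarrow> nat \<Rightarrow> (nat \<Rightarrow> 'v topology)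
     \<Rightarrow> (nat \<Rightarrow> 'x \<times> 'v \<Rightarrow> 'z::real_normed_vector \<times> 'u) \<Rightarrow> (nat \<Rightarrow> 'z \<times> 'u \<Rightarrow> real)
     \<Rightarrow> 'x \<Rightarrow> bool" where
  "robust_KKT F f K n V G g x \<longleftrightarrow>
     (\<exists>ys \<in> dual_cone K - {0}. \<exists>\<mu> :: nat \<Rightarrow> real. \<exists>v :: nat \<Rightarrow> 'v.
        (\<forall>i\<in>{1..n}. 0 \<le> \<mu> i) \<and>
        (\<forall>i\<in>{1..n}. v i \<in> topspace (V i)) \<and>
        0 \<in> (\<Union>ws\<in>limiting_subdifferential (scalarization ys f) (F x).
               limiting_subdifferential (scalarization ws F) x)
            + (\<Sum>i=1..n. (\<lambda>xs. \<mu> i *\<^sub>R xs) `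
                 weak_star_closed_hull
                   (\<Union>v\<in>active_params (V i) (G i) (g i) x. chain_subgradients (G i) (g i) (x, v))) \<and>
        (\<forall>i\<in>{1..n}. \<mu> i * worst_case (V i) (G i) (g i) x = \<mu> i * (g i \<circ> G i) (x, v i) \<and>
                    \<mu> i * (g i \<circ> G i) (x, v i) = 0))"

text \<open>The direction \<open>\<nu>\<close> may depend on \<open>x\<close>, \<open>ys\<close>, \<open>ws\<close> and \<open>xs\<close>, but it serves the whole
  family of active parameters and constraint subgradients simultaneously.  A separate
  direction for each single constraint subgradient would say nothing about convex
  combinations of these subgradients, which are what the KKT condition involves.\<close>

definition type_I_pseudo_convex ::
    "('x::real_normed_vector \<Rightarrow> 'w::real_normed_vector) \<Rightarrow> ('w \<Rightarrow> 'y::real_normed_vector)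
     \<Rightarrow> 'y set \<Rightarrow> nat \<Rightarrow> (nat \<Rightarrow> 'v topology)
     \<Rightarrow> (nat \<Rightarrow> 'x \<times> 'v \<Rightarrow> 'z::real_normed_vector \<times> 'u) \<Rightarrow> (nat \<Rightarrow> 'z \<times> 'u \<Rightarrow> real)
     \<Rightarrow> 'x \<Rightarrow> bool" where
  "type_I_pseudo_convex F f K n V G g xbar \<longleftrightarrow>
     (\<forall>x. \<forall>ys\<in>dual_cone K.
      \<forall>ws\<in>limiting_subdifferential (scalarization ys f) (F xbar).
      \<forall>xs\<in>limiting_subdifferential (scalarization ws F) xbar.
      \<exists>\<nu>. (scalarization ys (f \<circ> F) x < scalarization ys (f \<circ> F) xbar
             \<longrightarrow> blinfun_apply xs \<nu> < 0) \<and>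
          (\<forall>i\<in>{1..n}. \<forall>v\<in>active_params (V i) (G i) (g i) xbar.
             \<forall>vs\<in>partial_subdifferential (g i) (G i (xbar, v)).
             \<forall>xis\<in>partial_subdifferential (scalarization vs (fst \<circ> G i)) (xbar, v).
               (g i \<circ> G i) (x, v) \<le> (g i \<circ> G i) (xbar, v) \<longrightarrow> blinfun_apply xis \<nu> \<le> 0))"

definition type_II_pseudo_convex ::
    "('x::real_normed_vector \<Rightarrow> 'w::real_normed_vector) \<Rightarrow> ('w \<Rightarrow> 'y::real_normed_vector)
     \<Rightarrow> 'y set \<Rightarrow> nat \<Rightarrow> (nat \<Rightarrow> 'v topology)
     \<Rightarrow> (nat \<Rightarrow> 'x \<times> 'v \<Rightarrow> 'z::real_normed_vector \<times> 'u) \<Rightarrow> (nat \<Rightarrow> 'z \<times> 'u \<Rightarrow> real)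
     \<Rightarrow> 'x \<Rightarrow> bool" where
  "type_II_pseudo_convex F f K n V G g xbar \<longleftrightarrow>
     (\<forall>x\<in>- {xbar}. \<forall>ys\<in>dual_cone K - {0}.
      \<forall>ws\<in>limiting_subdifferential (scalarization ys f) (F xbar).
      \<forall>xs\<in>limiting_subdifferential (scalarization ws F) xbar.
      \<exists>\<nu>. (scalarization ys (f \<circ> F) x \<le> scalarization ys (f \<circ> F) xbar
             \<longrightarrow> blinfun_apply xs \<nu> < 0) \<and>
          (\<forall>i\<in>{1..n}. \<forall>v\<in>active_params (V i) (G i) (g i) xbar.
             \<forall>vs\<in>partial_subdifferential (g i) (G i (xbar, v)).
             \<forall>xis\<in>partial_subdifferential (scalarization vs (fst \<circ> G i)) (xbar, v).
               (g i \<circ> G i) (x, v) \<le> (g i \<circ> G i) (xbar, v) \<longrightarrow> blinfun_apply xis \<nu> \<le> 0))"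

end

theory Submission
  imports Defs
begin

text \<open>Pair the KKT inclusion \<open>0 = xs + (\<Sum>i. \<mu> i *\<^sub>R c i)\<close> with the direction \<open>\<nu>\<close> of
  pseudo convexity at a competitor \<open>x\<close>.  Where \<open>\<mu> i > 0\<close>, complementary slackness makes the
  active constraints vanish at the reference point, so they do not increase at \<open>x\<close> and the
  generating subgradients are nonpositive at \<open>\<nu>\<close>.  A half-space through the origin is convex and
  weak-star closed, so \<open>c i\<close> inherits this, and \<open>xs\<close> has to be nonnegative at \<open>\<nu>\<close>.\<close>

text \<open>Evaluation at \<open>\<nu>\<close> is continuous for pointwise convergence, so the
  half-space \<open>?H\<close> is weak-star closed. Being convex as well, it absorbs first the
  convex hull and then its closure. This carries bounds on single subgradients over to the hull
  elements of the KKT inclusion.\<close>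

lemma weak_star_closed_hull_apply_le:
  assumes "c \<in> weak_star_closed_hull S" and "\<And>s. s \<in> S \<Longrightarrow> blinfun_apply s \<nu> \<le> r"
  shows "blinfun_apply c \<nu> \<le> r"
proof -
  let ?H = "{c. blinfun_apply c \<nu> \<le> r}"
  have "closedin weak_star {c \<in> topspace weak_star. blinfun_apply c \<nu> \<in> {..r}}"
    by (rule closedin_continuous_map_preimage[OF strong_operator_topology_continuous_evaluation]) simp
  then have closed: "closedin weak_star ?H"
    by (simp add: strong_operator_topology_topspace)
  have "convex ?H"
    unfolding convex_def
    by (auto simp: blinfun.add_left blinfun.scaleR_left intro!: convex_bound_le)
  then have "convex hull S \<subseteq> ?H"
    using assms(2) by (intro hull_minimal) auto
  then show ?thesis
    using closure_of_minimal[OF _ closed] assms(1)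
    unfolding weak_star_closed_hull_def by blast
qed

text \<open>A nonzero functional is nonzero at some \<open>z\<close>. From an interior point one can
  move slightly in the direction along which the functional decreases and stay in \<open>K\<close>,
  where it is still nonnegative; so it was strictly positive before the move.\<close>

lemma dual_cone_interior_pos:
  assumes "ys \<in> dual_cone K" "ys \<noteq> 0" "y \<in> interior K"
  shows "0 < blinfun_apply ys y"
proof -
  obtain z where z: "blinfun_apply ys z \<noteq> 0"
    using assms(2) by (metis blinfun_eqI zero_blinfun.rep_eq)
  obtain e where e: "e > 0" "ball y e \<subseteq> K"
    using assms(3) by (auto simp: mem_interior)
  \<comment> \<open>The scale gives \<open>t *\<^sub>R z\<close> norm \<open>e / 2\<close>, inside
    the ball, and the sign makes \<open>t * blinfun_apply ys z\<close> positive.\<close>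
  define t where "t = e / (2 * norm z) * sgn (blinfun_apply ys z)"
  have "z \<noteq> 0" using z by auto
  then have "norm (t *\<^sub>R z) < e"
    using e(1) z by (simp add: t_def abs_mult abs_sgn_eq)
  then have "y - t *\<^sub>R z \<in> K"
    using e(2) by (auto simp: dist_norm)
  then have "t * blinfun_apply ys z \<le> blinfun_apply ys y"
    using assms(1) by (fastforce simp: dual_cone_def blinfun.diff_right blinfun.scaleR_right)
  moreover have "t * blinfun_apply ys z = e / (2 * norm z) * \<bar>blinfun_apply ys z\<bar>"
    by (simp add: t_def mult.assoc sgn_mult_self_eq abs_sgn mult.commute)
  then have "0 < t * blinfun_apply ys z"
    using e(1) z \<open>z \<noteq> 0\<close> by simp
  ultimately show ?thesis by linarith
qed

text \<open>Both parts of the theorem argue from the same data, so multipliers and hull elements are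
  eliminated once, here. \<open>xs\<close> is fixed before \<open>x\<close> and
  \<open>\<nu>\<close>, which lets the direction depend on it. The last premise repeats the
  constraint clause shared by both pseudo convexity notions, so their direction can be inserted
  directly.\<close>

lemma robust_KKT_E:
  assumes "robust_KKT F f K n V G g xbar"
  obtains ys ws xs where
    "ys \<in> dual_cone K" "ys \<noteq> 0"
    "ws \<in> limiting_subdifferential (scalarization ys f) (F xbar)"
    "xs \<in> limiting_subdifferential (scalarization ws F) xbar"
    "\<And>x \<nu>. \<lbrakk>x \<in> robust_feasible n V G g;
      \<forall>i\<in>{1..n}. \<forall>v\<in>active_params (V i) (G i) (g i) xbar.
        \<forall>vs\<in>partial_subdifferential (g i) (G i (xbar, v)).
        \<forall>xis\<in>partial_subdifferential (scalarization vs (fst \<circ> G i)) (xbar, v).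
          (g i \<circ> G i) (x, v) \<le> (g i \<circ> G i) (xbar, v) \<longrightarrow> blinfun_apply xis \<nu> \<le> 0\<rbrakk>
      \<Longrightarrow> 0 \<le> blinfun_apply xs \<nu>"
proof -
  let ?A = "\<lambda>i. \<Union>v\<in>active_params (V i) (G i) (g i) xbar. chain_subgradients (G i) (g i) (xbar, v)"
  from assms obtain ys \<mu> v where ys: "ys \<in> dual_cone K" "ys \<noteq> 0"
    and \<mu>: "\<And>i. i \<in> {1..n} \<Longrightarrow> 0 \<le> \<mu> i"
    and zero: "0 \<in> (\<Union>ws\<in>limiting_subdifferential (scalarization ys f) (F xbar).
               limiting_subdifferential (scalarization ws F) xbar)
            + (\<Sum>i=1..n. (\<lambda>xs. \<mu> i *\<^sub>R xs) ` weak_star_closed_hull (?A i))"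
    and slack: "\<And>i. i \<in> {1..n} \<Longrightarrow> \<mu> i * worst_case (V i) (G i) (g i) xbar = \<mu> i * (g i \<circ> G i) (xbar, v i)
                  \<and> \<mu> i * (g i \<circ> G i) (xbar, v i) = 0"
    unfolding robust_KKT_def by blast
  from zero obtain ws xs d where
      ws: "ws \<in> limiting_subdifferential (scalarization ys f) (F xbar)"
    and xs: "xs \<in> limiting_subdifferential (scalarization ws F) xbar"
    and d: "d \<in> (\<Sum>i=1..n. (\<lambda>xs. \<mu> i *\<^sub>R xs) ` weak_star_closed_hull (?A i))"
    and sum0: "0 = xs + d"
    by (elim set_plus_elim UN_E) blast
  \<comment> \<open>A member of a finite Minkowski sum is a sum of one chosen member per
    index.\<close>
  from d obtain s where s: "d = (\<Sum>i=1..n. s i)"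
      "\<And>i. i \<in> {1..n} \<Longrightarrow> s i \<in> (\<lambda>xs. \<mu> i *\<^sub>R xs) ` weak_star_closed_hull (?A i)"
    by (auto simp: set_sum_alt)
  have "0 \<le> blinfun_apply xs \<nu>"
    if x: "x \<in> robust_feasible n V G g"
      and sub: "\<forall>i\<in>{1..n}. \<forall>v\<in>active_params (V i) (G i) (g i) xbar.
        \<forall>vs\<in>partial_subdifferential (g i) (G i (xbar, v)).
        \<forall>xis\<in>partial_subdifferential (scalarization vs (fst \<circ> G i)) (xbar, v).
          (g i \<circ> G i) (x, v) \<le> (g i \<circ> G i) (xbar, v) \<longrightarrow> blinfun_apply xis \<nu> \<le> 0"
    for x \<nu>
  proof -
    have "blinfun_apply (s i) \<nu> \<le> 0" if i: "i \<in> {1..n}" for i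
    proof -
      obtain c where c: "s i = \<mu> i *\<^sub>R c" "c \<in> weak_star_closed_hull (?A i)"
        using s(2)[OF i] by blast
      show ?thesis
      \<comment> \<open>For \<open>\<mu> i = 0\<close> slackness says nothing about the worst case,
        but then the summand \<open>s i\<close> is itself zero.\<close>
      proof (cases "\<mu> i = 0")
        case False
        then have "worst_case (V i) (G i) (g i) xbar = 0"
          using slack[OF i] by auto
        \<comment> \<open>An active \<open>v\<close> attains the worst case at \<open>xbar\<close>,
          which is now zero, while feasibility bounds the value at \<open>x\<close> by zero.\<close>
        then have "(g i \<circ> G i) (x, v) \<le> (g i \<circ> G i) (xbar, v)"
          if "v \<in> active_params (V i) (G i) (g i) xbar" for v
          using that x i by (simp add: active_params_def robust_feasible_def)
        then have "blinfun_apply c \<nu> \<le> 0"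
          using sub i
          by (intro weak_star_closed_hull_apply_le[OF c(2)]) (auto simp: chain_subgradients_def)
        then show ?thesis
          using \<mu>[OF i] by (simp add: c(1) blinfun.scaleR_left mult_nonneg_nonpos)
      qed (simp add: c(1))
    qed
    then have "blinfun_apply d \<nu> \<le> 0"
      unfolding s(1) blinfun.sum_left by (rule sum_nonpos)
    moreover have "0 = blinfun_apply xs \<nu> + blinfun_apply d \<nu>"
      using sum0 by (metis blinfun.add_left blinfun.zero_left)
    ultimately show ?thesis by linarith
  qed
  with ys ws xs show thesis by (rule that)
qed

theorem theorem3p5:
  fixes F :: "'x::banach \<Rightarrow> 'w::banach"
    and f :: "'w \<Rightarrow> 'y::banach"
    and K :: "'y set"
    and n :: nat
    and V :: "nat \<Rightarrow> 'v topology"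
    and U :: "nat \<Rightarrow> 'u topology"
    and G :: "nat \<Rightarrow> 'x \<times> 'v \<Rightarrow> 'z::banach \<times> 'u"
    and g :: "nat \<Rightarrow> 'z \<times> 'u \<Rightarrow> real"
    and xbar :: 'x
  assumes asplund: "asplund_space TYPE('x)" "asplund_space TYPE('w)"
                   "asplund_space TYPE('y)" "asplund_space TYPE('z)"
    and cone: "cone K" "convex K" "closed K" "K \<inter> uminus ` K = {0}" "interior K \<noteq> {}"
    and n: "1 \<le> n"
    and V: "\<And>i. i \<in> {1..n} \<Longrightarrow> topspace (V i) \<noteq> {} \<and> sequentially_compact_space (V i)"
    and GU: "\<And>i. i \<in> {1..n} \<Longrightarrow> G i \<in> UNIV \<times> topspace (V i) \<rightarrow> UNIV \<times> topspace (U i)"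
    and A1: "locally_lipschitz_at F xbar" "locally_lipschitz_at f (F xbar)"
    and A2: "\<And>i. i \<in> {1..n} \<Longrightarrow>
               \<exists>\<delta>>0. \<exists>L. \<forall>v\<in>topspace (V i). L-lipschitz_on (ball xbar \<delta>) (\<lambda>x. fst (G i (x, v)))"
            "\<And>i. i \<in> {1..n} \<Longrightarrow>
               \<exists>\<delta>>0. \<exists>L. \<forall>v\<in>topspace (V i).
                 L-lipschitz_on (ball (fst (G i (xbar, v))) \<delta>) (\<lambda>z. g i (z, snd (G i (xbar, v))))"
    and A3: "\<And>i. i \<in> {1..n} \<Longrightarrow>
               \<exists>dV dU. mtopology_of dV = V i \<and> mtopology_of dU = U i \<and>
                 locally_lipschitz_map dV (prod_metric euclidean_metric dU) (\<lambda>v. G i (xbar, v)) \<and>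
                 locally_lipschitz_map
                   (submetric (prod_metric euclidean_metric dU)
                      ((\<lambda>v. G i (xbar, v)) ` topspace (V i)))
                   euclidean_metric (g i)"
    and A4: "\<And>i. i \<in> {1..n} \<Longrightarrow> maximum_attained (V i) (G i) (g i)"
            "\<And>i. i \<in> {1..n} \<Longrightarrow> locally_lipschitz_at (worst_case (V i) (G i) (g i)) xbar"
            "locally_lipschitz_at
               (\<lambda>x. Max ((\<lambda>i. worst_case (V i) (G i) (g i) x) ` {1..n})) xbar"
    and A5: "\<And>i v. i \<in> {1..n} \<Longrightarrow> v \<in> active_params (V i) (G i) (g i) xbar \<Longrightarrow>
               weak_star_seq_closed_at (V i) (partial_subdifferential (g i \<circ> G i)) (xbar, v)"
    and feasible: "xbar \<in> robust_feasible n V G g"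
    and KKT: "robust_KKT F f K n V G g xbar"
  shows "(type_I_pseudo_convex F f K n V G g xbar \<longrightarrow>
            xbar \<in> weakly_efficient_solutions K (f \<circ> F) (robust_feasible n V G g)) \<and>
         (type_II_pseudo_convex F f K n V G g xbar \<longrightarrow>
            xbar \<in> efficient_solutions K (f \<circ> F) (robust_feasible n V G g))"
proof -
  let ?C = "robust_feasible n V G g"
  obtain ys ws xs where ys: "ys \<in> dual_cone K" "ys \<noteq> 0"
    and ws: "ws \<in> limiting_subdifferential (scalarization ys f) (F xbar)"
    and xs: "xs \<in> limiting_subdifferential (scalarization ws F) xbar"
    and nonneg: "\<And>x \<nu>. \<lbrakk>x \<in> ?C;
      \<forall>i\<in>{1..n}. \<forall>v\<in>active_params (V i) (G i) (g i) xbar.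
        \<forall>vs\<in>partial_subdifferential (g i) (G i (xbar, v)).
        \<forall>xis\<in>partial_subdifferential (scalarization vs (fst \<circ> G i)) (xbar, v).
          (g i \<circ> G i) (x, v) \<le> (g i \<circ> G i) (xbar, v) \<longrightarrow> blinfun_apply xis \<nu> \<le> 0\<rbrakk>
      \<Longrightarrow> 0 \<le> blinfun_apply xs \<nu>"
    by (rule robust_KKT_E[OF KKT]) blast
  have diff: "blinfun_apply ys ((f \<circ> F) x - (f \<circ> F) xbar)
      = scalarization ys (f \<circ> F) x - scalarization ys (f \<circ> F) xbar" for x
    by (simp add: scalarization_def blinfun.diff_right)
  have "xbar \<in> weakly_efficient_solutions K (f \<circ> F) ?C"
    if I: "type_I_pseudo_convex F f K n V G g xbar"
  proof -
    have "(f \<circ> F) x - (f \<circ> F) xbar \<notin> uminus ` interior K" if x: "x \<in> ?C" for x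
    proof
      assume "(f \<circ> F) x - (f \<circ> F) xbar \<in> uminus ` interior K"
      then obtain k where k: "k \<in> interior K" "(f \<circ> F) x - (f \<circ> F) xbar = - k"
        by blast
      \<comment> \<open>An interior \<open>k\<close> gives strict decrease, exactly the trigger of
        the type I implication.\<close>
      have "scalarization ys (f \<circ> F) x < scalarization ys (f \<circ> F) xbar"
        using diff[of x] dual_cone_interior_pos[OF ys k(1)] unfolding k(2)
        by (simp add: blinfun.minus_right)
      with I ys(1) ws xs obtain \<nu> where "blinfun_apply xs \<nu> < 0"
        and "\<forall>i\<in>{1..n}. \<forall>v\<in>active_params (V i) (G i) (g i) xbar.
             \<forall>vs\<in>partial_subdifferential (g i) (G i (xbar, v)).
             \<forall>xis\<in>partial_subdifferential (scalarization vs (fst \<circ> G i)) (xbar, v).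
               (g i \<circ> G i) (x, v) \<le> (g i \<circ> G i) (xbar, v) \<longrightarrow> blinfun_apply xis \<nu> \<le> 0"
        unfolding type_I_pseudo_convex_def by meson
      with nonneg[OF x, of \<nu>] show False by force
    qed
    with feasible show ?thesis
      by (simp add: weakly_efficient_solutions_def)
  qed
  moreover have "xbar \<in> efficient_solutions K (f \<circ> F) ?C"
    if II: "type_II_pseudo_convex F f K n V G g xbar"
  proof -
    have "(f \<circ> F) x - (f \<circ> F) xbar \<notin> uminus ` K - {0}" if x: "x \<in> ?C" for x
    proof
      assume *: "(f \<circ> F) x - (f \<circ> F) xbar \<in> uminus ` K - {0}"
      then obtain k where k: "k \<in> K" "(f \<circ> F) x - (f \<circ> F) xbar = - k"
        by blast
      \<comment> \<open>Here \<open>k\<close> may lie on the boundary of \<open>K\<close>, where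
        \<open>ys\<close> can vanish. Only a nonstrict decrease follows, which is what type II
        accepts.\<close>
      have "0 \<le> blinfun_apply ys k"
        using ys(1) k(1) by (simp add: dual_cone_def)
      then have "scalarization ys (f \<circ> F) x \<le> scalarization ys (f \<circ> F) xbar"
        using diff[of x] unfolding k(2) by (simp add: blinfun.minus_right)
      \<comment> \<open>The excluded zero difference forces \<open>x\<close> to differ from
        \<open>xbar\<close>, as type II demands.\<close>
      moreover have "x \<in> - {xbar}" "ys \<in> dual_cone K - {0}"
        using * ys by auto
      ultimately obtain \<nu> where "blinfun_apply xs \<nu> < 0"
        and "\<forall>i\<in>{1..n}. \<forall>v\<in>active_params (V i) (G i) (g i) xbar.
             \<forall>vs\<in>partial_subdifferential (g i) (G i (xbar, v)).
             \<forall>xis\<in>partial_subdifferential (scalarization vs (fst \<circ> G i)) (xbar, v).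
               (g i \<circ> G i) (x, v) \<le> (g i \<circ> G i) (xbar, v) \<longrightarrow> blinfun_apply xis \<nu> \<le> 0"
        using II ws xs unfolding type_II_pseudo_convex_def by meson
      with nonneg[OF x, of \<nu>] show False by force
    qed
    with feasible show ?thesis
      by (simp add: efficient_solutions_def)
  qed
  ultimately show ?thesis by blast
qed

end
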